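(* Let $d,N\ge 1$, let $f$ be a function on $\mathbb{R}^d$, let $\varphi=\{\varphi_k\}_{k\ge(0,\dots,0)}$ be a multi-sequence of functions on $\mathbb{R}^d$ indexed by multi-indices $k=(k_1,\dots,k_d)$, and let $$F(x)=\sum_{j=1}^N a_j f(x-x^j),$$ where $a_1,\dots,a_N$ are scalars and $x^1,\dots,x^N\in\mathbb{R}^d$. Put $\mu_k=\int_{\mathbb{R}^d}F(t)\varphi_k(t)\,dt$ for every multi-index $k\ge(0,\dots,0)$. Suppose that the sequence $\psi=\{\psi_k\}_{k\ge(0,\dots,0)}$ with $\psi_k(t)=\sum_{0\le i\le k}C_{i,k}\varphi_i(t)$ is $f$-convolution dual to $\varphi$, and define $$M_k=\sum_{0\le i\le k}C_{i,k}\,\mu_i .$$ Then the parameters $a_j$ and $x^j$ satisfy the system of equations $$\sum_{j=1}^N a_j\,\varphi_k(x^j)=M_k\qquad\text{for all multi-indices } k\ge(0,\dots,0).$$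
   Context: Multi-indices are $d$-tuples of nonnegative integers, partially ordered by $k\le k'\Leftrightarrow k_p\le k'_p$ for all $p=1,\dots,d$; the sums $\sum_{0\le i\le k}$ run over multi-indices $i$ with $(0,\dots,0)\le i\le k$. A sequence $\psi=\{\psi_k\}_{k\ge(0,\dots,0)}$ is called $f$-convolution dual to $\varphi=\{\varphi_k\}$ if there are scalar coefficients $C_{i,k}$ (for $0\le i\le k$) such that $$\psi_k(t)=\sum_{0\le i\le k}C_{i,k}\varphi_i(t)\quad\text{for all }k\ge(0,\dots,0),$$ and $$\int_{\mathbb{R}^d} f(t-x)\,\psi_k(t)\,dt=\varphi_k(x)\quad\text{for all }x\in\mathbb{R}^d\text{ and all }k\ge(0,\dots,0).$$ Functions and scalars may be real or complex valued. All integrals involved are assumed to exist; in particular $t\mapsto f(t-x)\varphi_k(t)$ is integrable on $\mathbb{R}^d$ for all $x\in\mathbb{R}^d$ and all $k$. *)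

theory Defs
  imports "HOL-Analysis.Analysis"
begin

text \<open>
  Multi-indices are elements of \<open>nat ^ 'd\<close>, whose order \<open>\<le>\<close> is the componentwise one, so
  \<open>{0..k}\<close> is the set of multi-indices below \<open>k\<close>. It is finite, hence \<open>\<Sum>i\<in>{0..k}\<close> is not
  subject to the convention that sums over infinite sets are zero.
\<close>

lemma finite_multi_index_interval:
  fixes k :: "nat ^ 'd"
  shows "finite {0..k}"
proof (rule finite_subset)
  show "{0..k} \<subseteq> vec_lambda ` (\<Pi>\<^sub>E p\<in>UNIV. {0..k $ p})"
  proof
    fix i :: "nat ^ 'd" assume "i \<in> {0..k}"
    then have "vec_nth i \<in> (\<Pi>\<^sub>E p\<in>UNIV. {0..k $ p})"
      by (auto simp: less_eq_vec_def)
    then show "i \<in> vec_lambda ` (\<Pi>\<^sub>E p\<in>UNIV. {0..k $ p})"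
      by (metis image_eqI vec_lambda_eta)
  qed
  show "finite (vec_lambda ` (\<Pi>\<^sub>E p\<in>(UNIV :: 'd set). {0..k $ p}))"
    by (intro finite_imageI finite_PiE) auto
qed

text \<open>
  The scalar type \<open>'a\<close> is kept general enough to be \<open>real\<close> or \<open>complex\<close>. The predicate
  \<open>has_bochner_integral\<close> says that the Lebesgue integral exists and has the given value.
\<close>

definition convolution_dual ::
  "(real ^ 'd \<Rightarrow> 'a) \<Rightarrow> (nat ^ 'd \<Rightarrow> real ^ 'd \<Rightarrow> 'a)
    \<Rightarrow> (nat ^ 'd \<Rightarrow> real ^ 'd \<Rightarrow> 'a::{real_normed_field, banach, second_countable_topology}) \<Rightarrow> bool"
  where
  "convolution_dual f \<phi> \<psi> \<longleftrightarrow>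
    (\<exists>C :: nat ^ 'd \<Rightarrow> nat ^ 'd \<Rightarrow> 'a. \<forall>k t. \<psi> k t = (\<Sum>i\<in>{0..k}. C i k * \<phi> i t)) \<and>
    (\<forall>k x. has_bochner_integral lebesgue (\<lambda>t. f (t - x) * \<psi> k t) (\<phi> k x))"

end

theory Submission
  imports Defs
begin

text \<open>
  Both sides of the claimed equation are the integral of \<open>F * \<psi> k\<close>. Expanding \<open>\<psi> k\<close> into the
  functions \<open>\<phi> i\<close> expresses that integral through the moments \<open>\<mu> i\<close> and yields \<open>M k\<close>; expanding
  \<open>F\<close> into the shifts of \<open>f\<close> expresses it through the integrals of \<open>f (t - x j) * \<psi> k t\<close>, which
  duality evaluates to \<open>\<phi> k (x j)\<close>. The integral of a function is unique, so the two values agree.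
\<close>

theorem theorem1:
  fixes f F :: "real ^ 'd \<Rightarrow> 'a::{real_normed_field, banach, second_countable_topology}"
    and \<phi> \<psi> :: "nat ^ 'd \<Rightarrow> real ^ 'd \<Rightarrow> 'a"
    and N :: nat and a :: "nat \<Rightarrow> 'a" and x :: "nat \<Rightarrow> real ^ 'd"
    and C :: "nat ^ 'd \<Rightarrow> nat ^ 'd \<Rightarrow> 'a"
    and \<mu> M :: "nat ^ 'd \<Rightarrow> 'a"
  assumes "N \<ge> 1"
    and "\<And>k y. integrable lebesgue (\<lambda>t. f (t - y) * \<phi> k t)"
    and "\<And>y. F y = (\<Sum>j=1..N. a j * f (y - x j))"
    and "\<And>k. \<mu> k = integral\<^sup>L lebesgue (\<lambda>t. F t * \<phi> k t)"
    and "\<And>k t. \<psi> k t = (\<Sum>i\<in>{0..k}. C i k * \<phi> i t)"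
    and "convolution_dual f \<phi> \<psi>"
    and "\<And>k. M k = (\<Sum>i\<in>{0..k}. C i k * \<mu> i)"
  shows "\<forall>k. (\<Sum>j=1..N. a j * \<phi> k (x j)) = M k"
proof
  fix k
  have dual: "has_bochner_integral lebesgue (\<lambda>t. f (t - y) * \<psi> k t) (\<phi> k y)" for y
    using assms(6) unfolding convolution_dual_def by blast
  have "has_bochner_integral lebesgue
      (\<lambda>t. \<Sum>j=1..N. a j * (f (t - x j) * \<psi> k t)) (\<Sum>j=1..N. a j * \<phi> k (x j))"
    by (intro has_bochner_integral_sum has_bochner_integral_mult_right dual)
  then have by_shifts: "has_bochner_integral lebesgue (\<lambda>t. F t * \<psi> k t) (\<Sum>j=1..N. a j * \<phi> k (x j))"
    by (simp add: assms(3) sum_distrib_right mult.assoc)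
  have moment: "has_bochner_integral lebesgue (\<lambda>t. F t * \<phi> i t) (\<mu> i)" for i
  proof -
    have "integrable lebesgue (\<lambda>t. \<Sum>j=1..N. a j * (f (t - x j) * \<phi> i t))"
      by (intro Bochner_Integration.integrable_sum integrable_mult_right assms(2))
    then have "integrable lebesgue (\<lambda>t. F t * \<phi> i t)"
      by (simp add: assms(3) sum_distrib_right mult.assoc)
    then show ?thesis
      unfolding assms(4) by (rule has_bochner_integral_integrable)
  qed
  have "has_bochner_integral lebesgue
      (\<lambda>t. \<Sum>i\<in>{0..k}. C i k * (F t * \<phi> i t)) (\<Sum>i\<in>{0..k}. C i k * \<mu> i)"
    by (intro has_bochner_integral_sum has_bochner_integral_mult_right moment)
  then have by_moments: "has_bochner_integral lebesgue (\<lambda>t. F t * \<psi> k t) (M k)"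
    by (simp add: assms(5) assms(7) sum_distrib_left mult.left_commute)
  show "(\<Sum>j=1..N. a j * \<phi> k (x j)) = M k"
    using by_shifts by_moments by (rule has_bochner_integral_eq)
qed

end
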